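(* For every $i\ge1$, the word $b_4$ avoids $T_i$.
   Context: A formula is a finite set of non-empty words over variables (fragments), written separated by dots. An occurrence of a formula $f$ in a word $w$ is a non-erasing morphism $h$ from variables to non-empty words such that $h(\phi)$ is a factor of $w$ for every fragment $\phi$; $w$ avoids $f$ if it has no occurrence. For $i\ge1$, $T_i$ is the formula on variables $A_0,\dots,A_{i-1}$ whose fragments are the $i$ words $A_jA_{j+1}A_j$, $0\le j\le i-1$, indices modulo $i$. $b_4$ is the fixed point starting with $0$ of the morphism $0\mapsto 01,\ 1\mapsto 03,\ 2\mapsto 21,\ 3\mapsto 23$. *)

theory Defs
  imports Main "HOL-Library.Omega_Words_Fun"
begin

text \<open>Infinite words are functions on \<^typ>\<open>nat\<close>; \<open>w [i \<rightarrow> j]\<close> is the finite word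
  \<open>w i \<dots> w (j - 1)\<close>.\<close>

definition apply_morphism :: "('v \<Rightarrow> 'a list) \<Rightarrow> 'v list \<Rightarrow> 'a list" where
  "apply_morphism h u = concat (map h u)"

definition factor_of :: "'a list \<Rightarrow> 'a word \<Rightarrow> bool" where
  "factor_of u w \<longleftrightarrow> (\<exists>i j. i \<le> j \<and> u = w [i \<rightarrow> j])"

definition is_formula :: "'v list set \<Rightarrow> bool" where
  "is_formula f \<longleftrightarrow> finite f \<and> [] \<notin> f"

definition variables :: "'v list set \<Rightarrow> 'v set" where
  "variables f = (\<Union>\<phi>\<in>f. set \<phi>)"

definition is_occurrence :: "('v \<Rightarrow> 'a list) \<Rightarrow> 'v list set \<Rightarrow> 'a word \<Rightarrow> bool" where
  "is_occurrence h f w \<longleftrightarrow>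
     (\<forall>v\<in>variables f. h v \<noteq> []) \<and> (\<forall>\<phi>\<in>f. factor_of (apply_morphism h \<phi>) w)"

definition avoids :: "'a word \<Rightarrow> 'v list set \<Rightarrow> bool" where
  "avoids w f \<longleftrightarrow> (\<nexists>h. is_occurrence h f w)"

definition T :: "nat \<Rightarrow> nat list set" where
  "T i = {[j, (j + 1) mod i, j] | j. j < i}"

lemma is_formula_T: "is_formula (T i)"
  by (auto simp: is_formula_def T_def)

lemma variables_T: "variables (T i) = {..<i}"
  by (auto simp: variables_def T_def intro!: exI)

text \<open>An infinite word \<open>w\<close> satisfies \<open>h(w) = w\<close>, for a non-erasing \<open>h\<close>, iff the image of every
  finite prefix of \<open>w\<close> is again a prefix of \<open>w\<close>.\<close>

definition is_fixed_point :: "('a \<Rightarrow> 'a list) \<Rightarrow> 'a word \<Rightarrow> bool" where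
  "is_fixed_point h w \<longleftrightarrow>
     (\<forall>n. \<exists>m. apply_morphism h (w [0 \<rightarrow> n]) = w [0 \<rightarrow> m])"

datatype letter = L0 | L1 | L2 | L3

primrec b4_morphism :: "letter \<Rightarrow> letter list" where
  "b4_morphism L0 = [L0, L1]"
| "b4_morphism L1 = [L0, L3]"
| "b4_morphism L2 = [L2, L1]"
| "b4_morphism L3 = [L2, L3]"

definition b4 :: "letter word" where
  "b4 = (THE w. is_fixed_point b4_morphism w \<and> w 0 = L0)"

lemma length_b4_morphism: "length (b4_morphism a) = 2"
  by (cases a) auto

lemma length_apply_b4_morphism: "length (apply_morphism b4_morphism u) = 2 * length u"
  by (induction u) (auto simp: apply_morphism_def length_b4_morphism)

lemma b4_morphism_eq: "b4_morphism a = [b4_morphism a ! 0, b4_morphism a ! 1]"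
  by (cases a) auto

lemma is_fixed_point_b4_morphism_iff:
  "is_fixed_point b4_morphism w \<longleftrightarrow>
     (\<forall>n. w (2 * n) = b4_morphism (w n) ! 0 \<and> w (2 * n + 1) = b4_morphism (w n) ! 1)"
  (is "_ \<longleftrightarrow> ?R")
proof
  assume fp: "is_fixed_point b4_morphism w"
  have img: "apply_morphism b4_morphism (w [0 \<rightarrow> n]) = w [0 \<rightarrow> 2 * n]" for n
  proof -
    obtain m where m: "apply_morphism b4_morphism (w [0 \<rightarrow> n]) = w [0 \<rightarrow> m]"
      using fp by (auto simp: is_fixed_point_def)
    then have "m = 2 * n"
      using length_apply_b4_morphism[of "w [0 \<rightarrow> n]"] by simp
    with m show ?thesis by simp
  qed
  show ?R
  proof
    fix n
    have "w [0 \<rightarrow> 2 * n] @ b4_morphism (w n) = w [0 \<rightarrow> 2 * n] @ [w (2 * n), w (2 * n + 1)]"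
      using img[of "Suc n"] img[of n] by (simp add: apply_morphism_def subsequence_def)
    then show "w (2 * n) = b4_morphism (w n) ! 0 \<and> w (2 * n + 1) = b4_morphism (w n) ! 1"
      by simp
  qed
next
  assume R: ?R
  have "apply_morphism b4_morphism (w [0 \<rightarrow> n]) = w [0 \<rightarrow> 2 * n]" for n
  proof (induction n)
    case 0
    show ?case by (simp add: apply_morphism_def subsequence_def)
  next
    case (Suc n)
    have "b4_morphism (w n) = [w (2 * n), w (2 * n + 1)]"
      using R b4_morphism_eq[of "w n"] by simp
    with Suc show ?case by (simp add: apply_morphism_def subsequence_def)
  qed
  then show "is_fixed_point b4_morphism w"
    by (auto simp: is_fixed_point_def)
qed

fun b4_rec :: "nat \<Rightarrow> letter" where
  "b4_rec n = (if n = 0 then L0 else b4_morphism (b4_rec (n div 2)) ! (n mod 2))"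

declare b4_rec.simps [simp del]

lemma ex1_b4: "\<exists>!w. is_fixed_point b4_morphism w \<and> w 0 = L0"
proof (rule ex1I[of _ b4_rec])
  have "b4_rec (2 * n) = b4_morphism (b4_rec n) ! 0 \<and>
        b4_rec (2 * n + 1) = b4_morphism (b4_rec n) ! 1" for n
    by (cases "n = 0") (simp_all add: b4_rec.simps[of "2 * n"] b4_rec.simps[of "Suc (2 * n)"]
        b4_rec.simps[of 0] b4_rec.simps[of "Suc 0"])
  then show "is_fixed_point b4_morphism b4_rec \<and> b4_rec 0 = L0"
    by (simp add: is_fixed_point_b4_morphism_iff b4_rec.simps)
next
  fix w assume w: "is_fixed_point b4_morphism w \<and> w 0 = L0"
  have "w n = b4_rec n" for n
  proof (induction n rule: less_induct)
    case (less n)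
    show ?case
    proof (cases "n = 0")
      case True
      then show ?thesis using w by (simp add: b4_rec.simps)
    next
      case False
      have "w n = b4_morphism (w (n div 2)) ! (n mod 2)"
      proof (cases "even n")
        case True
        then obtain k where "n = 2 * k" by (elim evenE)
        then show ?thesis using w by (simp add: is_fixed_point_b4_morphism_iff)
      next
        case False
        then obtain k where "n = 2 * k + 1" by (elim oddE)
        then show ?thesis using w by (simp add: is_fixed_point_b4_morphism_iff)
      qed
      then show ?thesis
        using less[of "n div 2"] False by (simp add: b4_rec.simps[of n])
    qed
  qed
  then show "w = b4_rec" by auto
qed

lemma b4_fixed_point: "is_fixed_point b4_morphism b4" and b4_0: "b4 0 = L0"
  using theI'[OF ex1_b4] by (auto simp: b4_def)

end

theory Submission
  imports Defs "HOL-Library.Discrete_Functions"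
begin

text \<open>Whether \<open>b4\<close> takes a letter in \<open>{L0, L1}\<close> at position \<open>2 ^ v * (2 * m + 1)\<close> depends only on
  the parity of \<open>m\<close>, as in the paperfolding word. Hence two occurrences of a factor of length at
  least \<open>2 ^ k\<close> are at positions congruent modulo \<open>2 ^ (k + 1)\<close>. Given an occurrence of \<open>T i\<close>, start
  at a shortest image and follow the cyclic order backwards, which gives words \<open>L 0, L 1, \<dots>\<close> such that
  each \<open>L (n + 1) L n L (n + 1)\<close> is a factor. As long as the lengths do not decrease, the congruence
  forces \<open>|L n| + |L (n + 1)| = 2 ^ (k + 1)\<close> with \<open>2 ^ k \<le> |L (n + 1)| < 2 ^ (k + 1)\<close>, and it pins down a
  position inside \<open>L n\<close> whose absolute position is highly divisible by 2. If the length decreased for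
  the first time, comparing these positions would exhibit a letter that differs between the two
  copies of \<open>L (n + 1)\<close>. So the lengths grow without bound, although only \<open>i\<close> words occur.\<close>

section \<open>Paperfolding structure of \<open>b4\<close> and congruences between
  occurrences\<close>

definition low :: "letter \<Rightarrow> bool" where
  "low a \<longleftrightarrow> a = L0 \<or> a = L1"

definition occurs_at :: "letter list \<Rightarrow> nat \<Rightarrow> bool" where
  "occurs_at u q \<longleftrightarrow> (\<forall>r<length u. b4 (q + r) = u ! r)"

lemma b4_double: "b4 (2 * n) = b4_morphism (b4 n) ! 0"
  and b4_double_Suc: "b4 (2 * n + 1) = b4_morphism (b4 n) ! 1"
  using b4_fixed_point by (auto simp: is_fixed_point_b4_morphism_iff)

lemma b4_even_iff: "b4 n \<in> {L0, L2} \<longleftrightarrow> even n"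
proof (cases "even n")
  case True
  then obtain k where "n = 2 * k" by (elim evenE)
  then show ?thesis using True b4_double[of k] by (cases "b4 k") auto
next
  case False
  then obtain k where "n = 2 * k + 1" by (elim oddE)
  then show ?thesis using False b4_double_Suc[of k] by (cases "b4 k") auto
qed

text \<open>First letters of images under \<open>b4_morphism\<close> are low exactly when the
  preimage is, so doubling a position preserves lowness. At odd positions, the second letter of an
  image is low exactly when the preimage is \<open>L0\<close> or \<open>L2\<close>, that is, stands
  at an even position.\<close>

lemma low_b4: "low (b4 (2 ^ v * (2 * m + 1))) \<longleftrightarrow> even m"
proof (induction v)
  case 0
  show ?case using b4_double_Suc[of m] b4_even_iff[of m] by (cases "b4 m") (auto simp: low_def)
next
  case (Suc v)
  then show ?case using b4_double[of "2 ^ v * (2 * m + 1)"]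
    by (cases "b4 (2 ^ v * (2 * m + 1))") (auto simp: low_def mult.assoc)
qed

text \<open>With \<open>m = 2 * a + 1\<close>, the shift replaces \<open>a\<close> by
  \<open>a + d\<close>, which has the other parity, so \<open>low_b4\<close> separates the two
  letters. Integers let \<open>m\<close> and \<open>d\<close> be given by differences.\<close>

lemma b4_neq:
  fixes u u' v :: nat and m d :: int
  assumes u: "int u = 2 ^ v * m" and "odd m"
    and u': "int u' = int u + 2 ^ (v + 1) * d" and "odd d"
  shows "b4 u \<noteq> b4 u'"
proof -
  have pos: "m \<ge> 0" "m + 2 * d \<ge> 0"
  proof -
    have "0 \<le> 2 ^ v * m" using u by (metis of_nat_0_le_iff)
    then show "m \<ge> 0" by (simp add: zero_le_mult_iff)
    have "int u' = 2 ^ v * (m + 2 * d)" using u u' by (simp add: algebra_simps)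
    then have "0 \<le> 2 ^ v * (m + 2 * d)" by (metis of_nat_0_le_iff)
    then show "m + 2 * d \<ge> 0" by (simp add: zero_le_mult_iff)
  qed
  obtain a where a: "m = 2 * a + 1" using \<open>odd m\<close> by (elim oddE)
  have nn: "a \<ge> 0" "a + d \<ge> 0" using pos a by presburger+
  have 1: "u = 2 ^ v * (2 * nat a + 1)"
    using u nn a by (simp add: algebra_simps flip: of_nat_eq_iff[where 'a = int])
  have "int u' = int (2 ^ v * (2 * nat (a + d) + 1))"
    using u u' nn a by (simp add: algebra_simps)
  then have 2: "u' = 2 ^ v * (2 * nat (a + d) + 1)" by (simp only: of_nat_eq_iff)
  have "even (nat a) \<noteq> even (nat (a + d))"
    using nn \<open>odd d\<close> by (simp add: even_nat_iff)
  then show ?thesis using low_b4[of v "nat a"] low_b4[of v "nat (a + d)"] 1 2 by metis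
qed

lemma ex_multiple_in_window:
  fixes q k :: nat
  shows "\<exists>r<2 ^ k. 2 ^ k dvd q + r"
proof (cases "2 ^ k dvd q")
  case True
  then show ?thesis by (intro exI[of _ 0]) auto
next
  case False
  then have "0 < q mod 2 ^ k" by (simp add: mod_greater_zero_iff_not_dvd)
  moreover have "q mod 2 ^ k < 2 ^ k" by simp
  moreover have "q + (2 ^ k - q mod 2 ^ k) = 2 ^ k * (q div 2 ^ k + 1)"
    using mult_div_mod_eq[of "2 ^ k" q] \<open>q mod 2 ^ k < 2 ^ k\<close>
    by (simp only: distrib_left mult_1_right)
  ultimately show ?thesis by (intro exI[of _ "2 ^ k - q mod 2 ^ k"]) auto
qed

text \<open>Induction on \<open>k\<close>: a window of length \<open>2 ^ (k + 1)\<close> contains an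
  odd multiple of \<open>2 ^ k\<close>, and by \<open>b4_neq\<close> the letter there would change
  if the shift were an odd multiple of \<open>2 ^ (k + 1)\<close>.\<close>

lemma occurs_at_cong:
  assumes "occurs_at u q" "occurs_at u q'" "2 ^ k \<le> length u"
  shows "2 ^ (k + 1) dvd int q' - int q"
  using assms(3)
proof (induction k)
  case 0
  then have "b4 q = b4 q'" using assms(1,2) by (force simp: occurs_at_def)
  then have "even q = even q'" using b4_even_iff by metis
  then show ?case by auto
next
  case (Suc k)
  then have IH: "2 ^ (k + 1) dvd int q' - int q" by simp
  obtain r0 where r0: "r0 < 2 ^ k" "2 ^ k dvd q + r0" using ex_multiple_in_window by blast
  then obtain m0 where m0: "q + r0 = 2 ^ k * m0" by blast
  \<comment> \<open>Of two consecutive multiples of \<open>2 ^ k\<close>, one has an odd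
    quotient.\<close>
  obtain r m where r: "r < 2 ^ (k + 1)" "q + r = 2 ^ k * m" "odd m"
  proof (cases "odd m0")
    case True
    then show ?thesis using r0 m0 that[of r0 m0] by simp
  next
    case False
    then show ?thesis using r0 m0 that[of "r0 + 2 ^ k" "m0 + 1"] by simp
  qed
  have eq: "b4 (q + r) = b4 (q' + r)"
    using r(1) Suc.prems assms(1,2) by (simp add: occurs_at_def)
  obtain d where d: "int q' - int q = 2 ^ (k + 1) * d" using IH by blast
  have "int (q + r) = 2 ^ k * int m" using arg_cong[OF r(2), of int] by simp
  moreover have "int (q' + r) = int (q + r) + 2 ^ (k + 1) * d" using d by simp
  ultimately have "even d" using b4_neq[of "q + r" k "int m" "q' + r" d] r(3) eq by auto
  then show ?case using d by auto
qed

text \<open>A repetition at distance \<open>2 ^ (k + 1)\<close> excludes odd multiples of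
  \<open>2 ^ k\<close> from the window. The multiple at offset \<open>c\<close> is therefore even,
  and both its neighbours, at offsets \<open>c - 2 ^ k\<close> and \<open>c + 2 ^ k\<close>, lie
  outside; the last two bounds say this.\<close>

lemma ex_center:
  assumes occ: "occurs_at u q" "occurs_at u (q + 2 ^ (k + 1))" and len: "2 ^ k \<le> length u"
  shows "\<exists>c. c < length u \<and> c < 2 ^ k \<and> length u \<le> c + 2 ^ k \<and>
    (\<forall>q'. occurs_at u q' \<longrightarrow> 2 ^ (k + 1) dvd int q' + int c)"
proof -
  have no_odd: "even m" if "r < length u" "q + r = 2 ^ k * m" for r m
  proof (rule ccontr)
    assume "odd m"
    then have "b4 (q + r) \<noteq> b4 (q + 2 ^ (k + 1) + r)"
      using arg_cong[OF that(2), of int]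
      by (intro b4_neq[where v = k and m = "int m" and d = 1]) auto
    then show False using occ that(1) by (simp add: occurs_at_def)
  qed
  obtain c m where c: "c < 2 ^ k" "q + c = 2 ^ k * m" using ex_multiple_in_window by blast
  have "c < length u" using c len by simp
  then have "even m" using no_odd c by blast
  have "length u \<le> c + 2 ^ k"
    using no_odd[of "c + 2 ^ k" "m + 1"] c \<open>even m\<close> by (cases "c + 2 ^ k < length u") auto
  moreover have "2 ^ (k + 1) dvd int q' + int c" if "occurs_at u q'" for q'
  proof -
    have "int q + int c = 2 ^ k * int m" using arg_cong[OF c(2), of int] by simp
    then have "2 ^ (k + 1) dvd int q + int c" using \<open>even m\<close> by auto
    from dvd_add[OF occurs_at_cong[OF occ(1) that len] this] show ?thesis by simp
  qed
  ultimately show ?thesis using c \<open>c < length u\<close> by blast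
qed

section \<open>Lengths and centers along a backward chain\<close>

locale backward_chain =
  fixes L :: "nat \<Rightarrow> letter list" and p :: "nat \<Rightarrow> nat"
  assumes nonempty: "L n \<noteq> []"
    and shortest: "length (L 0) \<le> length (L n)"
    and occ_left: "occurs_at (L (Suc n)) (p n)"
    and occ_mid: "occurs_at (L n) (p n + length (L (Suc n)))"
    and occ_right: "occurs_at (L (Suc n)) (p n + length (L (Suc n)) + length (L n))"
begin

abbreviation l :: "nat \<Rightarrow> nat" where
  "l n \<equiv> length (L n)"

abbreviation K :: "nat \<Rightarrow> nat" where
  "K n \<equiv> floor_log (l n)"

definition ascent :: "nat \<Rightarrow> bool" where
  "ascent n \<longleftrightarrow> l n \<le> l (Suc n) \<and> l n + l (Suc n) = 2 ^ (K (Suc n) + 1)"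

definition is_center :: "nat \<Rightarrow> nat \<Rightarrow> bool" where
  "is_center n c \<longleftrightarrow> c < l n \<and> c < 2 ^ K n \<and> l n \<le> c + 2 ^ K n \<and>
    (\<forall>q. occurs_at (L n) q \<longrightarrow> 2 ^ (K n + 1) dvd int q + int c)"

text \<open>For \<open>n > 0\<close> the offset of the unique multiple of \<open>2 ^ K n\<close> covered by occurrences of \<open>L n\<close>;
  other occurrences of \<open>L 0\<close> than those between two copies of \<open>L 1\<close> need not have a multiple at
  offset \<open>center 0\<close>.\<close>

definition center :: "nat \<Rightarrow> nat" where
  "center n = (if n = 0 then (SOME c. is_center 1 c) + 2 ^ K 1 - l 1 else (SOME c. is_center n c))"

lemma l_pos: "0 < l n"
  using nonempty by simp

lemma K_le: "2 ^ K n \<le> l n"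
  using floor_log_exp2_le[OF l_pos] .

lemma K_gt: "l n < 2 ^ (K n + 1)"
  using floor_log_exp2_gt[of "l n"] by simp

lemma K_gt_int: "int (l n) < 2 ^ (K n + 1)"
proof -
  have "int (l n) < int (2 ^ (K n + 1))" using K_gt by (simp only: of_nat_less_iff)
  then show ?thesis by simp
qed

lemma K_mono: "l m \<le> l n \<Longrightarrow> K m \<le> K n"
  by (rule floor_log_le_iff)

lemma period_dvd: "2 ^ (K (Suc n) + 1) dvd int (l (Suc n)) + int (l n)"
  using occurs_at_cong[OF occ_left occ_right K_le, of n] by simp

text \<open>The sum of the lengths is a positive multiple of \<open>2 ^ (K (Suc n) + 1)\<close>, and
  both summands are smaller than this power.\<close>

lemma ascentI:
  assumes "l n \<le> l (Suc n)"
  shows "ascent n"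
proof -
  obtain d where d: "int (l (Suc n)) + int (l n) = 2 ^ (K (Suc n) + 1) * d"
    using period_dvd by blast
  have "0 < 2 ^ (K (Suc n) + 1) * d" using d l_pos[of n] by linarith
  then have "0 < d" by (simp add: zero_less_mult_iff)
  have "2 ^ (K (Suc n) + 1) * d < 2 ^ (K (Suc n) + 1) * 2"
    using d assms K_gt_int[of "Suc n"] by linarith
  then have "d < 2" by simp
  with \<open>0 < d\<close> have "d = 1" by simp
  then have "int (l n + l (Suc n)) = int (2 ^ (K (Suc n) + 1))" using d by simp
  then show ?thesis using assms unfolding ascent_def of_nat_eq_iff by simp
qed

lemma ascent_sum:
  assumes "ascent n"
  shows "int (l n) + int (l (Suc n)) = 2 * 2 ^ K (Suc n)"
proof -
  have "int (l n + l (Suc n)) = int (2 ^ (K (Suc n) + 1))" using assms by (simp only: ascent_def)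
  then show ?thesis by simp
qed

lemma is_center_center:
  assumes "ascent n"
  shows "is_center (Suc n) (center (Suc n))"
proof -
  have "occurs_at (L (Suc n)) (p n + 2 ^ (K (Suc n) + 1))"
    using occ_right[of n] assms by (simp add: ascent_def add.commute add.left_commute)
  from ex_center[OF occ_left this K_le] have "\<exists>c. is_center (Suc n) c"
    by (auto simp: is_center_def)
  then show ?thesis by (simp add: center_def someI_ex)
qed

text \<open>Halfway between the centers of the two copies of \<open>L (Suc n)\<close> lies an odd
  multiple of \<open>2 ^ K (Suc n)\<close>. It falls inside \<open>L n\<close>, so for
  \<open>n > 0\<close> it must be the center of \<open>L n\<close>; as that center is a multiple of
  \<open>2 ^ (K n + 1)\<close>, the exponents differ.\<close>

lemma center_Suc:
  assumes "ascent n" "n = 0 \<or> ascent (n - 1)"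
  shows "center n + l (Suc n) = center (Suc n) + 2 ^ K (Suc n)" "center n < l n"
    "n \<noteq> 0 \<Longrightarrow> K n < K (Suc n)"
proof -
  let ?c = "center (Suc n)" and ?k = "K (Suc n)"
  have c: "?c < l (Suc n)" "?c < 2 ^ ?k" "l (Suc n) \<le> ?c + 2 ^ ?k"
    "2 ^ (?k + 1) dvd int (p n) + int ?c"
    using is_center_center[OF assms(1)] occ_left[of n] by (auto simp: is_center_def)
  have sum: "l n + l (Suc n) = 2 ^ ?k + 2 ^ ?k" using assms(1) by (simp add: ascent_def)
  define r where "r = ?c + 2 ^ ?k - l (Suc n)"
  have r: "r < l n" "r + l (Suc n) = ?c + 2 ^ ?k" using c sum by (auto simp: r_def)
  have "center n = r \<and> (n \<noteq> 0 \<longrightarrow> K n < ?k)"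
  proof (cases n)
    case 0
    \<comment> \<open>\<open>center 0\<close> is defined to be exactly this midpoint offset.\<close>
    then show ?thesis by (simp add: r_def center_def)
  next
    case (Suc n')
    have le: "K n \<le> ?k" using assms(1) by (intro K_mono) (simp add: ascent_def)
    have d: "center n < 2 ^ K n" "l n \<le> center n + 2 ^ K n"
      "2 ^ (K n + 1) dvd int (p n + l (Suc n)) + int (center n)"
      using is_center_center[of n'] assms(2) Suc occ_mid[of n] by (auto simp: is_center_def)
    obtain e where e: "int (p n) + int ?c = 2 ^ (?k + 1) * e" using c by blast
    have y: "int (p n + l (Suc n)) + int r = 2 ^ ?k * (2 * e + 1)"
      using e arg_cong[OF r(2), of int] by (simp add: algebra_simps)
    then have "2 ^ ?k dvd int (p n + l (Suc n)) + int r" by simp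
    then have "2 ^ K n dvd int (p n + l (Suc n)) + int r"
      using le_imp_power_dvd[OF le] dvd_trans by blast
    moreover have "2 ^ K n dvd int (p n + l (Suc n)) + int (center n)"
      using d(3) by (meson dvd_trans le_add1 le_imp_power_dvd)
    ultimately have "2 ^ K n dvd (int (p n + l (Suc n)) + int r) - (int (p n + l (Suc n)) + int (center n))"
      by (rule dvd_diff)
    then have dv: "2 ^ K n dvd int r - int (center n)" by simp
    \<comment> \<open>Two multiples of \<open>2 ^ K n\<close> less than \<open>2 ^ K n\<close> apart
      coincide.\<close>
    have "r < center n + 2 ^ K n" using r(1) d(2) by linarith
    then have "int r < int (center n + 2 ^ K n)" "int (center n) < int (2 ^ K n)"
      using d(1) by (simp_all only: of_nat_less_iff)
    then have "\<bar>int r - int (center n)\<bar> < 2 ^ K n"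
      unfolding of_nat_add of_nat_power of_nat_numeral by linarith
    then have eq: "center n = r" using dv zdvd_not_zless[of "\<bar>int r - int (center n)\<bar>" "2 ^ K n"] by force
    have "K n \<noteq> ?k"
    proof
      assume "K n = ?k"
      then obtain f where "2 ^ ?k * (2 * e + 1) = 2 ^ (?k + 1) * f"
        using d(3) eq y by (metis dvdE)
      then have "2 ^ ?k * (2 * e + 1) = 2 ^ ?k * (2 * f)" by simp
      then have "2 * e + 1 = 2 * f" by (simp only: mult_cancel_left) simp
      then show False by presburger
    qed
    then show ?thesis using eq le by simp
  qed
  then show "center n + l (Suc n) = center (Suc n) + 2 ^ K (Suc n)" "center n < l n"
    "n \<noteq> 0 \<Longrightarrow> K n < K (Suc n)" using r by auto
qed

text \<open>The number \<open>S\<close> is the alternating sum of the powers \<open>2 ^ K j\<close> for \<open>t < j \<le> n\<close>; the two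
  alternatives correspond to the parity of \<open>n - t\<close>.\<close>

lemma center_alternating:
  assumes asc: "\<And>m. m < n \<Longrightarrow> ascent m" and "t < n"
  shows "K (Suc t) \<le> K n \<and> (\<exists>s S :: int. odd s \<and> S = 2 ^ K (Suc t) * s \<and>
    (int (center n) + int (l t) - int (center t) = S \<and> int (l n) - int (center n) + int (center t) = S \<or>
     int (center n) - int (center t) = S \<and>
     (int (l n) - int (center n)) - (int (l t) - int (center t)) = S))"
proof -
  have "Suc t \<le> n" using assms(2) by simp
  then show ?thesis using asc
  proof (induction n rule: dec_induct)
    case base
    have a: "ascent t" "t = 0 \<or> ascent (t - 1)" using base by auto
    have "int (center t) + int (l (Suc t)) = int (center (Suc t)) + 2 ^ K (Suc t)"
      using arg_cong[OF center_Suc(1)[OF a], of int] by simp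
    moreover have "int (l t) + int (l (Suc t)) = 2 * 2 ^ K (Suc t)"
      by (rule ascent_sum[OF a(1)])
    ultimately show ?case by (intro conjI exI[of _ 1] exI[of _ "2 ^ K (Suc t)"] disjI1) auto
  next
    case (step n)
    have a: "ascent n" "n = 0 \<or> ascent (n - 1)" using step by auto
    obtain s S :: int where IH: "K (Suc t) \<le> K n" "odd s" "S = 2 ^ K (Suc t) * s"
      "int (center n) + int (l t) - int (center t) = S \<and> int (l n) - int (center n) + int (center t) = S \<or>
       int (center n) - int (center t) = S \<and>
       (int (l n) - int (center n)) - (int (l t) - int (center t)) = S"
      using step by (metis less_SucI)
    have c: "int (center n) + int (l (Suc n)) = int (center (Suc n)) + 2 ^ K (Suc n)"
      using arg_cong[OF center_Suc(1)[OF a], of int] by simp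
    have sum: "int (l n) + int (l (Suc n)) = 2 * 2 ^ K (Suc n)"
      by (rule ascent_sum[OF a(1)])
    have lt: "K n < K (Suc n)" using center_Suc(3)[OF a] step by simp
    define e where "e = K (Suc n) - K (Suc t)"
    have e: "K (Suc n) = K (Suc t) + e" "0 < e" using lt IH(1) by (auto simp: e_def)
    \<comment> \<open>Passing from \<open>S\<close> to \<open>2 ^ K (Suc n) - S\<close> swaps the
      two alternatives; the strict growth of \<open>K\<close> keeps the cofactor odd.\<close>
    have "odd (2 ^ e - s)" using IH(2) e(2) by simp
    moreover have "2 ^ K (Suc n) - S = 2 ^ K (Suc t) * (2 ^ e - s)"
      by (simp add: e(1) IH(3) power_add algebra_simps)
    ultimately show ?case using lt IH(1,4) c sum
      by (intro conjI exI[of _ "2 ^ e - s"] exI[of _ "2 ^ K (Suc n) - S"]) auto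
  qed
qed

text \<open>At a first descent, the new length \<open>z\<close> is placed between two consecutive
  earlier lengths \<open>l t\<close> and \<open>l (Suc t)\<close>. Divisibility of the period then
  forces \<open>z = l t\<close> or \<open>z + l t = 2 ^ (i + 1)\<close>, according to the
  alternative in \<open>center_alternating\<close>. Either way \<open>b4_neq\<close> finds a
  mismatch between the two copies of \<open>L (Suc n)\<close>.\<close>

lemma ascent_step:
  assumes asc: "\<And>m. m < n \<Longrightarrow> ascent m"
  shows "ascent n"
proof (rule ascentI, rule ccontr)
  assume "\<not> l n \<le> l (Suc n)"
  then have desc: "l (Suc n) < l n" by simp
  define z i q where "z = l (Suc n)" and "i = K (Suc n)" and "q = p n"
  obtain t where t: "t < n" "l t \<le> z" "z < l (Suc t)"
  proof -
    define t where "t = (LEAST t. z < l (Suc t))"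
    have "n \<noteq> 0" using desc shortest[of "Suc n"] by (metis not_less)
    then have ex: "z < l (Suc (n - 1))" using desc by (simp add: z_def)
    have "z < l (Suc t)" unfolding t_def by (rule LeastI, rule ex)
    moreover have "t \<le> n - 1" unfolding t_def by (rule Least_le, rule ex)
    moreover have "l t \<le> z"
    proof (cases t)
      case 0
      then show ?thesis using shortest by (simp add: z_def)
    next
      case (Suc t')
      then show ?thesis using not_less_Least[of t' "\<lambda>t. z < l (Suc t)"] by (simp add: t_def)
    qed
    ultimately show ?thesis using \<open>n \<noteq> 0\<close> by (intro that[of t]) auto
  qed
  have at: "ascent t" "t = 0 \<or> ascent (t - 1)" using asc t by auto
  have ct: "center t < l t" using center_Suc(2)[OF at] .
  obtain n' where n': "n = Suc n'" using t(1) by (cases n) auto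
  obtain s S :: int where D: "K (Suc t) \<le> K n" "odd s" "S = 2 ^ K (Suc t) * s"
    "int (center n) + int (l t) - int (center t) = S \<and> int (l n) - int (center n) + int (center t) = S \<or>
     int (center n) - int (center t) = S \<and>
     (int (l n) - int (center n)) - (int (l t) - int (center t)) = S"
    using center_alternating[OF asc t(1)] by metis
  have iK: "i \<le> K (Suc t)" using K_mono[of "Suc n" "Suc t"] t(3) by (simp add: i_def z_def)
  have zlt: "int z < 2 ^ (i + 1)" using K_gt_int[of "Suc n"] by (simp add: i_def z_def)
  have ltz: "int (l t) \<le> int z" using t(2) by simp
  have per: "2 ^ (i + 1) dvd int z + int (l n)" using period_dvd[of n] by (simp add: i_def z_def)
  have S2: "2 ^ (i + 1) dvd 2 * S" using D(3) iK by (simp add: le_imp_power_dvd dvd_mult2)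
  obtain x where x: "int q + int z + int (center n) = 2 ^ (K n + 1) * x"
    using is_center_center[of n'] asc[of n'] occ_mid[of n] n'
    by (auto simp: is_center_def z_def q_def elim!: dvdE)
  define e where "e = K n - K (Suc t)"
  have x': "int q + int z + int (center n) = 2 ^ K (Suc t) * (2 * (2 ^ e * x))"
  proof -
    have "K n = K (Suc t) + e" using D(1) by (simp add: e_def)
    then show ?thesis using x by (simp add: power_add mult_ac)
  qed
  have same: "b4 (q + r) = b4 (q + z + l n + r)" if "r < z" for r
    using occ_left[of n] occ_right[of n] that by (simp add: occurs_at_def q_def z_def)
  from D(4) show False
  proof
    assume A: "int (center n) + int (l t) - int (center t) = S \<and> int (l n) - int (center n) + int (center t) = S"
    then have "int z - int (l t) = (int z + int (l n)) - 2 * S" by linarith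
    then have "2 ^ (i + 1) dvd int z - int (l t)" using dvd_diff[OF per S2] by (simp only:)
    then have zt: "int z = int (l t)"
      using zdvd_not_zless[of "int z - int (l t)" "2 ^ (i + 1)"] zlt ltz l_pos[of t] by force
    \<comment> \<open>This position lies \<open>S\<close> before the center of the middle word,
      hence is an odd multiple of \<open>2 ^ K (Suc t)\<close>; the period is
      \<open>2 * S\<close>.\<close>
    have "b4 (q + center t) \<noteq> b4 (q + z + l n + center t)"
    proof (rule b4_neq)
      have "int (q + center t) = (int q + int z + int (center n)) - S" using A zt by simp
      then show "int (q + center t) = 2 ^ K (Suc t) * (2 * (2 ^ e * x) - s)"
        using x' D(3) by (simp add: algebra_simps)
      show "int (q + z + l n + center t) = int (q + center t) + 2 ^ (K (Suc t) + 1) * s"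
        using A zt D(3) by simp
    qed (use D(2) in auto)
    then show False using same[of "center t"] ct zt by simp
  next
    assume A: "int (center n) - int (center t) = S \<and>
      (int (l n) - int (center n)) - (int (l t) - int (center t)) = S"
    then have "int z + int (l t) = (int z + int (l n)) - 2 * S" by linarith
    then have "2 ^ (i + 1) dvd int z + int (l t)" using dvd_diff[OF per S2] by (simp only:)
    then obtain d where d: "int z + int (l t) = 2 ^ (i + 1) * d" by blast
    have "0 < 2 ^ (i + 1) * d" using d l_pos[of t] by linarith
    then have "0 < d" by (simp add: zero_less_mult_iff)
    have "2 ^ (i + 1) * d < 2 ^ (i + 1) * 2" using d zlt ltz by linarith
    then have "d < 2" by simp
    with \<open>0 < d\<close> d have "int z + int (l t) = 2 ^ (i + 1)" by (cases "d = 1") auto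
    then have "int (z + l t) = int (2 ^ (i + 1))" by simp
    then have zt: "z + l t = 2 ^ (i + 1)" by (simp only: of_nat_eq_iff)
    \<comment> \<open>Equality would give \<open>z + l t = l t + l (Suc t)\<close>, against
      \<open>z < l (Suc t)\<close>.\<close>
    have "i \<noteq> K (Suc t)" using zt at(1) t(3) by (auto simp: ascent_def)
    then have "0 < K (Suc t) - i" using iK by simp
    define g where "g = K (Suc t) - i"
    have g: "K (Suc t) = i + g" "0 < g" using \<open>0 < K (Suc t) - i\<close> by (auto simp: g_def)
    \<comment> \<open>Chosen so that \<open>q + r\<close> lies \<open>S + 2 ^ i\<close> before the
      center of the middle word. As \<open>i < K (Suc t)\<close>, it is an odd multiple of
      \<open>2 ^ i\<close>, and the period \<open>2 ^ (i + 1) + 2 * S\<close> is an odd multiple of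
      \<open>2 ^ (i + 1)\<close>.\<close>
    define r where "r = 2 ^ i + center t - l t"
    have r: "r + l t = 2 ^ i + center t" "r < z" using zt t(2) ct by (auto simp: r_def)
    have r': "int r + int (l t) = 2 ^ i + int (center t)" using arg_cong[OF r(1), of int] by simp
    have zt': "int z + int (l t) = 2 * 2 ^ i" using arg_cong[OF zt, of int] by simp
    have "b4 (q + r) \<noteq> b4 (q + z + l n + r)"
    proof (rule b4_neq)
      have "int (q + r) = (int q + int z + int (center n)) - S - 2 ^ i" using A zt' r' by simp
      then show "int (q + r) = 2 ^ i * (2 ^ g * (2 * (2 ^ e * x) - s) - 1)"
        using x' D(3) g by (simp add: algebra_simps power_add)
      have "int (q + z + l n + r) = int (q + r) + 2 * 2 ^ i + 2 * S" using A zt' by simp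
      then show "int (q + z + l n + r) = int (q + r) + 2 ^ (i + 1) * (1 + 2 ^ g * s)"
        using D(3) g by (simp add: algebra_simps power_add)
    qed (use g(2) in auto)
    then show False using same r(2) by simp
  qed
qed

lemma ascent: "ascent n"
  by (induction n rule: less_induct) (rule ascent_step)

text \<open>From index 1 on, the exponents \<open>K\<close> increase strictly.\<close>

lemma length_unbounded: "2 ^ n \<le> l (Suc n)"
proof -
  have "n \<le> K (Suc n)"
  proof (induction n)
    case (Suc n)
    then show ?case using center_Suc(3)[of "Suc n"] ascent by simp
  qed simp
  then have "(2 :: nat) ^ n \<le> 2 ^ K (Suc n)" by simp
  then show ?thesis using K_le le_trans by blast
qed

end

section \<open>From an occurrence of \<open>T i\<close> to a backward chain\<close>

lemma factor_of_b4_iff: "factor_of u b4 \<longleftrightarrow> (\<exists>q. occurs_at u q)"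
proof
  assume "factor_of u b4"
  then obtain a b where "u = b4 [a \<rightarrow> b]" by (auto simp: factor_of_def)
  then show "\<exists>q. occurs_at u q" by (auto simp: occurs_at_def subsequence_def intro!: exI[of _ a])
next
  assume "\<exists>q. occurs_at u q"
  then obtain q where "occurs_at u q" ..
  then have "u = b4 [q \<rightarrow> q + length u]"
    by (auto simp: occurs_at_def subsequence_def intro!: nth_equalityI)
  then show "factor_of u b4" unfolding factor_of_def by (metis le_add1)
qed

lemma occurs_at_append: "occurs_at (u @ v) q \<longleftrightarrow> occurs_at u q \<and> occurs_at v (q + length u)"
proof
  assume A: "occurs_at (u @ v) q"
  have "b4 (q + length u + r) = v ! r" if "r < length v" for r
    using A[unfolded occurs_at_def, rule_format, of "length u + r"] that by (simp add: add.assoc)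
  moreover have "b4 (q + r) = u ! r" if "r < length u" for r
    using A[unfolded occurs_at_def, rule_format, of r] that by (simp add: nth_append)
  ultimately show "occurs_at u q \<and> occurs_at v (q + length u)" by (simp add: occurs_at_def)
next
  assume A: "occurs_at u q \<and> occurs_at v (q + length u)"
  show "occurs_at (u @ v) q" unfolding occurs_at_def
  proof (intro allI impI)
    fix r assume r: "r < length (u @ v)"
    show "b4 (q + r) = (u @ v) ! r"
    proof (cases "r < length u")
      case True
      then show ?thesis using A by (simp add: occurs_at_def nth_append)
    next
      case False
      then have "b4 (q + length u + (r - length u)) = v ! (r - length u)"
        using A r unfolding occurs_at_def by (metis add_less_cancel_left le_add_diff_inverse length_append not_less)
      then show ?thesis using False by (simp add: nth_append)
    qed
  qed
qed

theorem theorem13: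
  fixes i :: nat
  assumes "i \<ge> 1"
  shows "avoids b4 (T i)"
  unfolding avoids_def
proof
  assume "\<exists>h. is_occurrence h (T i) b4"
  then obtain h where h: "is_occurrence h (T i) b4" ..
  have ne: "h j \<noteq> []" if "j < i" for j
    using h that by (simp add: is_occurrence_def variables_T)
  have "\<exists>q. occurs_at (h j @ h ((j + 1) mod i) @ h j) q" if "j < i" for j
  proof -
    have "[j, (j + 1) mod i, j] \<in> T i" using that by (auto simp: T_def)
    then have "factor_of (apply_morphism h [j, (j + 1) mod i, j]) b4"
      using h unfolding is_occurrence_def by blast
    then show ?thesis by (simp add: apply_morphism_def factor_of_b4_iff)
  qed
  then obtain pos where pos: "\<And>j. j < i \<Longrightarrow> occurs_at (h j @ h ((j + 1) mod i) @ h j) (pos j)"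
    by metis
  obtain j0 where j0: "j0 < i" "\<And>j. j < i \<Longrightarrow> length (h j0) \<le> length (h j)"
    using ex_has_least_nat[of "\<lambda>j. j < i" 0 "\<lambda>j. length (h j)"] assms by auto
  \<comment> \<open>Adding \<open>i - 1\<close> modulo \<open>i\<close> steps back by one without
    natural-number underflow.\<close>
  define idx where "idx n = (j0 + n * (i - 1)) mod i" for n
  have idx: "idx n < i" for n using assms by (simp add: idx_def)
  have idx_Suc: "(idx (Suc n) + 1) mod i = idx n" for n
  proof -
    have "j0 + Suc n * (i - 1) + 1 = j0 + n * (i - 1) + i" using assms by simp
    then show ?thesis unfolding idx_def mod_add_left_eq by (metis mod_add_self2)
  qed
  interpret backward_chain "\<lambda>n. h (idx n)" "\<lambda>n. pos (idx (Suc n))"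
  proof
    fix n
    show "h (idx n) \<noteq> []" using ne idx by blast
    have "idx 0 = j0" using j0(1) by (simp add: idx_def)
    then show "length (h (idx 0)) \<le> length (h (idx n))" using j0(2) idx by simp
    have "occurs_at (h (idx (Suc n)) @ h (idx n) @ h (idx (Suc n))) (pos (idx (Suc n)))"
      using pos[OF idx[of "Suc n"]] idx_Suc[of n] by simp
    then show "occurs_at (h (idx (Suc n))) (pos (idx (Suc n)))"
      "occurs_at (h (idx n)) (pos (idx (Suc n)) + length (h (idx (Suc n))))"
      "occurs_at (h (idx (Suc n))) (pos (idx (Suc n)) + length (h (idx (Suc n))) + length (h (idx n)))"
      by (simp_all add: occurs_at_append)
  qed
  define M where "M = Max ((\<lambda>j. length (h j)) ` {..<i})"
  have "length (h (idx (Suc M))) \<le> M" unfolding M_def using idx by (intro Max_ge) auto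
  then show False using length_unbounded[of M] less_exp[of M] by linarith
qed

end
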